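(* Suppose $0\le q\le n-1$ and let $\Theta:C\setminus\{o\}\to(0,\infty)$ be continuous and positively homogeneous of degree $-q$. Let $E_1,E_2$ be $(C,\Theta)$-close sets. Then $$\overline{V}_\Theta(E_1+E_2)^{\frac{1}{n-q}}\le\overline{V}_\Theta(E_1)^{\frac{1}{n-q}}+\overline{V}_\Theta(E_2)^{\frac{1}{n-q}}.$$ Moreover, if $q\in[0,n-1)$, equality holds if and only if $E_1$ and $E_2$ are dilates of each other.
   Context: $C\subset\mathbb{R}^n$ ($n\ge2$) is a pointed closed convex cone with nonempty interior. A $C$-pseudo-cone is a nonempty closed convex set $E$ with $o\notin E$, $\lambda x\in E$ for all $x\in E,\lambda\ge1$, and recession cone $\{x:E+x\subset E\}$ equal to $C$. $\overline{V}_\Theta(E)=\int_{C\setminus E}\Theta\,d\mathcal{H}^n$. For $0\le q\le n-1$, a $(C,\Theta)$-close set is a $C$-pseudo-cone $E$ with $\overline{V}_\Theta(E)<\infty$. $E_1+E_2$ denotes the Minkowski sum. Dilates: $E_2=\lambda E_1$ for some $\lambda>0$. *)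

theory Defs
  imports "HOL-Analysis.Analysis"
begin

definition pointed_cone :: "'a::euclidean_space set \<Rightarrow> bool" where
  "pointed_cone C \<longleftrightarrow> closed C \<and> convex C \<and> cone C \<and> C \<inter> uminus ` C = {0} \<and> interior C \<noteq> {}"

definition rec_cone :: "'a::euclidean_space set \<Rightarrow> 'a set" where
  "rec_cone E = {x. \<forall>y\<in>E. y + x \<in> E}"

definition pseudo_cone :: "'a::euclidean_space set \<Rightarrow> 'a set \<Rightarrow> bool" where
  "pseudo_cone C E \<longleftrightarrow> E \<noteq> {} \<and> closed E \<and> convex E \<and> 0 \<notin> E \<and>
     (\<forall>x\<in>E. \<forall>l::real. l \<ge> 1 \<longrightarrow> l *\<^sub>R x \<in> E) \<and> rec_cone E = C"

text \<open>Theta-covolume: integral of Theta over C minus E w.r.t. Lebesgue measure (= H^n).\<close>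
definition covol :: "'a::euclidean_space set \<Rightarrow> ('a \<Rightarrow> real) \<Rightarrow> 'a set \<Rightarrow> ennreal" where
  "covol C \<Theta> E = (\<integral>\<^sup>+ x \<in> C - E. ennreal (\<Theta> x) \<partial>lebesgue)"

definition close_set :: "'a::euclidean_space set \<Rightarrow> ('a \<Rightarrow> real) \<Rightarrow> 'a set \<Rightarrow> bool" where
  "close_set C \<Theta> E \<longleftrightarrow> pseudo_cone C E \<and> covol C \<Theta> E < \<infinity>"

definition msum :: "'a::euclidean_space set \<Rightarrow> 'a set \<Rightarrow> 'a set" where
  "msum A B = {x + y | x y. x \<in> A \<and> y \<in> B}"

definition dilates :: "'a::euclidean_space set \<Rightarrow> 'a set \<Rightarrow> bool" where
  "dilates A B \<longleftrightarrow> (\<exists>l::real. l > 0 \<and> B = (\<lambda>x. l *\<^sub>R x) ` A)"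

end

theory Submission
  imports Defs
begin

text \<open>
  Write p = n - q \<ge> 1. Homogeneity of \<Theta> of degree -q makes the \<Theta>-measure of the part of
  C - {o} of norm less than c scale like c powr p on every scale-invariant subset. Integrating
  over the level sets of the radial function r_E (the distance from o to E along a ray) gives
  the polar formula V(E) = \<integral> r_E(x) powr p d\<mu>, where \<mu> is \<Theta> restricted to the unit ball
  of C. Since the rays where r_E is undefined carry no mass when V(E) is finite, and
  r_(E1+E2) \<le> r_E1 + r_E2 along every ray, Minkowski's inequality in L^p(\<mu>) yields the
  inequality. For p > 1 equality in Minkowski's inequality forces r_E1 and r_E2 to be
  proportional almost everywhere, and two closed convex sets with nonempty interior that agree
  almost everywhere are equal.
\<close>

section \<open>Real power inequalities\<close>

lemma powr_bernoulli_strict: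
  fixes p h :: real
  assumes p: "p > 1" and h: "h \<ge> -1" "h \<noteq> 0"
  shows "1 + p * h < (1 + h) powr p"
proof (cases "h = -1")
  case True
  then show ?thesis using p by simp
next
  case False
  define g where "g x = (1 + x) powr p - 1 - p * x" for x :: real
  have g': "DERIV g x :> p * ((1 + x) powr (p - 1) - 1)" if "x > -1" for x
    unfolding g_def using that by (auto intro!: derivative_eq_intros simp: algebra_simps)
  have "g h > 0"
  proof (cases "h > 0")
    case True
    obtain z where z: "0 < z" "z < h" "g h - g 0 = h * (p * ((1 + z) powr (p - 1) - 1))"
      using MVT2[of 0 h g "\<lambda>x. p * ((1 + x) powr (p - 1) - 1)"] True g' by force
    have "1 < (1 + z) powr (p - 1)" using z p by (intro gr_one_powr) auto
    then show ?thesis using z True p by (simp add: g_def)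
  next
    case False
    then have h_neg: "h < 0" and h_gt: "h > -1" using h \<open>h \<noteq> -1\<close> by auto
    obtain z where z: "h < z" "z < 0" "g 0 - g h = (0 - h) * (p * ((1 + z) powr (p - 1) - 1))"
      using MVT2[of h 0 g "\<lambda>x. p * ((1 + x) powr (p - 1) - 1)"] h_neg h_gt g' by force
    have "(1 + z) powr (p - 1) < 1 powr (p - 1)" using z p h_gt by (intro powr_less_mono2) auto
    then have "p * ((1 + z) powr (p - 1) - 1) < 0" using p by (simp add: mult_pos_neg)
    then have "h * (p * ((1 + z) powr (p - 1) - 1)) > 0" using h_neg by (simp add: mult_neg_neg)
    then show ?thesis using z by (simp add: g_def)
  qed
  then show ?thesis by (simp add: g_def)
qed

lemma powr_bernoulli:
  fixes p h :: real
  assumes "p \<ge> 1" and "h \<ge> -1"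
  shows "1 + p * h \<le> (1 + h) powr p"
  using powr_bernoulli_strict[of p h] assms by (cases "p = 1 \<or> h = 0") fastforce+

lemma powr_above_tangent:
  fixes p m w :: real
  assumes p: "p \<ge> 1" and m: "m > 0" and w: "w \<ge> 0"
  shows "m powr p + p * m powr (p - 1) * (w - m) \<le> w powr p"
    and "p > 1 \<Longrightarrow> w \<noteq> m \<Longrightarrow> m powr p + p * m powr (p - 1) * (w - m) < w powr p"
proof -
  define h where "h = w / m - 1"
  have h: "h \<ge> -1" using m w by (simp add: h_def)
  have w_eq: "w = m * (1 + h)" using m by (simp add: h_def)
  have w_powr: "w powr p = m powr p * (1 + h) powr p"
    using w_eq m h by (simp add: powr_mult)
  have tangent: "m powr p + p * m powr (p - 1) * (w - m) = m powr p * (1 + p * h)"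
    using m by (simp add: w_eq powr_diff algebra_simps)
  show "m powr p + p * m powr (p - 1) * (w - m) \<le> w powr p"
    unfolding w_powr tangent using powr_bernoulli[OF p h] m by simp
  assume "p > 1" "w \<noteq> m"
  moreover have "h \<noteq> 0" using m \<open>w \<noteq> m\<close> by (simp add: h_def)
  ultimately show "m powr p + p * m powr (p - 1) * (w - m) < w powr p"
    unfolding w_powr tangent using powr_bernoulli_strict[OF _ h] m by simp
qed

lemma powr_weighted_mean_le:
  fixes p a b u v :: real
  assumes p: "p \<ge> 1" and a: "a > 0" and b: "b > 0" and u: "u \<ge> 0" and v: "v \<ge> 0"
  shows "(a + b) * ((a * u + b * v) / (a + b)) powr p \<le> a * u powr p + b * v powr p"
    and "p > 1 \<Longrightarrow> u \<noteq> v \<Longrightarrow>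
           (a + b) * ((a * u + b * v) / (a + b)) powr p < a * u powr p + b * v powr p"
proof -
  define m where "m = (a * u + b * v) / (a + b)"
  define tangent where "tangent w = m powr p + p * m powr (p - 1) * (w - m)" for w
  have m_nonneg: "m \<ge> 0" using a b u v by (simp add: m_def)
  have m_zero: "u = 0 \<and> v = 0" if "m = 0"
    using that a b u v by (auto simp: m_def divide_eq_0_iff add_nonneg_eq_0_iff)
  have tangent_mean: "a * tangent u + b * tangent v = (a + b) * m powr p"
  proof -
    have "a * tangent u + b * tangent v
        = (a + b) * m powr p + p * m powr (p - 1) * (a * u + b * v - (a + b) * m)"
      by (simp add: tangent_def algebra_simps)
    also have "a * u + b * v = (a + b) * m" using a b by (simp add: m_def)
    finally show ?thesis by simp
  qed
  show "(a + b) * m powr p \<le> a * u powr p + b * v powr p"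
  proof (cases "m = 0")
    case True
    then show ?thesis using m_zero by simp
  next
    case False
    then have "m > 0" using m_nonneg by simp
    then have "tangent u \<le> u powr p" "tangent v \<le> v powr p"
      unfolding tangent_def using powr_above_tangent(1) p u v by auto
    then show ?thesis
      using tangent_mean a b by (smt (verit) mult_left_mono)
  qed
  assume p1: "p > 1" and "u \<noteq> v"
  then have "m > 0" using m_zero m_nonneg by force
  have "tangent u \<le> u powr p" "tangent v \<le> v powr p"
    unfolding tangent_def using powr_above_tangent(1) p u v \<open>m > 0\<close> by auto
  moreover have "tangent u < u powr p \<or> tangent v < v powr p"
    unfolding tangent_def using powr_above_tangent(2) p p1 u v \<open>m > 0\<close> \<open>u \<noteq> v\<close> by metis
  ultimately show "(a + b) * m powr p < a * u powr p + b * v powr p"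
    using tangent_mean a b by (smt (verit) mult_left_mono mult_strict_left_mono)
qed

lemma powr_add_le_weighted:
  fixes p a b x y :: real
  assumes p: "p \<ge> 1" and a: "a > 0" and b: "b > 0" and x: "x \<ge> 0" and y: "y \<ge> 0"
  shows "(x + y) powr p \<le> (a + b) powr (p - 1) * (x powr p / a powr (p - 1) + y powr p / b powr (p - 1))"
    and "p > 1 \<Longrightarrow>
      (x + y) powr p = (a + b) powr (p - 1) * (x powr p / a powr (p - 1) + y powr p / b powr (p - 1)) \<Longrightarrow>
      x * b = y * a"
proof -
  define u v where "u = x / a" and "v = y / b"
  have uv: "u \<ge> 0" "v \<ge> 0" "a * u + b * v = x + y" using a b x y by (simp_all add: u_def v_def)
  have "(x + y) powr p = ((a + b) * ((x + y) / (a + b))) powr p" using a b by simp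
  also have "\<dots> = (a + b) powr p * ((x + y) / (a + b)) powr p"
    using a b x y by (intro powr_mult)
  also have "(a + b) powr p = (a + b) powr (p - 1) * (a + b)"
    using a b powr_add[of "a + b" "p - 1" 1] by simp
  finally have lhs: "(x + y) powr p = (a + b) powr (p - 1) * ((a + b) * ((a * u + b * v) / (a + b)) powr p)"
    by (simp add: uv(3))
  have rhs: "x powr p / a powr (p - 1) + y powr p / b powr (p - 1) = a * u powr p + b * v powr p"
    using a b x y by (simp add: u_def v_def powr_divide powr_diff field_simps)
  have pos: "(a + b) powr (p - 1) > 0" using a b by simp
  show "(x + y) powr p \<le> (a + b) powr (p - 1) * (x powr p / a powr (p - 1) + y powr p / b powr (p - 1))"
    unfolding lhs rhs using powr_weighted_mean_le(1)[OF p a b uv(1,2)] pos by simp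
  assume "p > 1" and "(x + y) powr p = (a + b) powr (p - 1) * (x powr p / a powr (p - 1) + y powr p / b powr (p - 1))"
  then have "\<not> (a + b) * ((a * u + b * v) / (a + b)) powr p < a * u powr p + b * v powr p"
    unfolding lhs rhs using pos by simp
  then have "u = v" using powr_weighted_mean_le(2)[OF p a b uv(1,2) \<open>p > 1\<close>] by blast
  then show "x * b = y * a" using a b by (simp add: u_def v_def field_simps)
qed

lemma powr_inverse_le_iff:
  fixes y s p :: real
  assumes "y \<ge> 0" "s \<ge> 0" "p > 0"
  shows "y powr (1 / p) \<le> s \<longleftrightarrow> y \<le> s powr p"
proof
  assume "y powr (1 / p) \<le> s"
  then have "(y powr (1 / p)) powr p \<le> s powr p" using assms by (intro powr_mono2) auto
  then show "y \<le> s powr p" using assms by (simp add: powr_powr)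
next
  assume "y \<le> s powr p"
  then have "y powr (1 / p) \<le> (s powr p) powr (1 / p)" using assms by (intro powr_mono2) auto
  then show "y powr (1 / p) \<le> s" using assms by (simp add: powr_powr)
qed

lemma powr_inverse_eq_iff:
  fixes y s p :: real
  assumes "y \<ge> 0" "s \<ge> 0" "p > 0"
  shows "y powr (1 / p) = s \<longleftrightarrow> y = s powr p"
  using assms by (auto simp: powr_powr)

section \<open>Minkowski's inequality and Lebesgue measure\<close>

lemma nn_integral_powr_add_le:
  fixes f g :: "'b \<Rightarrow> real" and p a b :: real
  assumes p: "p \<ge> 1" and a: "a > 0" and b: "b > 0"
    and [measurable]: "f \<in> borel_measurable M" "g \<in> borel_measurable M"
    and f: "\<And>x. f x \<ge> 0" and g: "\<And>x. g x \<ge> 0"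
    and int_f: "(\<integral>\<^sup>+x. ennreal (f x powr p) \<partial>M) = ennreal (a powr p)"
    and int_g: "(\<integral>\<^sup>+x. ennreal (g x powr p) \<partial>M) = ennreal (b powr p)"
  shows "(\<integral>\<^sup>+x. ennreal ((f x + g x) powr p) \<partial>M) \<le> ennreal ((a + b) powr p)"
    and "p > 1 \<Longrightarrow> (\<integral>\<^sup>+x. ennreal ((f x + g x) powr p) \<partial>M) = ennreal ((a + b) powr p) \<Longrightarrow>
           AE x in M. f x * b = g x * a"
proof -
  define Ka Kb where "Ka = (a + b) powr (p - 1) / a powr (p - 1)"
    and "Kb = (a + b) powr (p - 1) / b powr (p - 1)"
  \<comment> \<open>H majorizes (f + g) powr p pointwise and integrates to exactly (a + b) powr p.\<close>
  define H where "H x = Ka * f x powr p + Kb * g x powr p" for x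
  have [measurable]: "H \<in> borel_measurable M" unfolding H_def by measurable
  have K: "Ka \<ge> 0" "Kb \<ge> 0" by (simp_all add: Ka_def Kb_def)
  have H_ge: "(f x + g x) powr p \<le> H x" for x
    using powr_add_le_weighted(1)[OF p a b f g] by (simp add: H_def Ka_def Kb_def algebra_simps)
  have powr_split: "x powr p = x powr (p - 1) * x" if "x > 0" for x :: real
    using powr_add[of x "p - 1" 1] that by simp
  have "(\<integral>\<^sup>+x. ennreal (H x) \<partial>M)
      = (\<integral>\<^sup>+x. ennreal Ka * ennreal (f x powr p) + ennreal Kb * ennreal (g x powr p) \<partial>M)"
    using K by (intro nn_integral_cong) (simp add: H_def ennreal_mult ennreal_plus)
  also have "\<dots> = ennreal Ka * ennreal (a powr p) + ennreal Kb * ennreal (b powr p)"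
    by (simp add: nn_integral_add nn_integral_cmult int_f int_g)
  also have "\<dots> = ennreal (Ka * a powr p + Kb * b powr p)"
    using K by (simp add: ennreal_mult ennreal_plus)
  also have "Ka * a powr p + Kb * b powr p = (a + b) powr (p - 1) * (a + b)"
    using a b by (simp add: Ka_def Kb_def powr_split algebra_simps)
  also have "\<dots> = (a + b) powr p" using a b by (simp add: powr_split)
  finally have int_H: "(\<integral>\<^sup>+x. ennreal (H x) \<partial>M) = ennreal ((a + b) powr p)" .
  show "(\<integral>\<^sup>+x. ennreal ((f x + g x) powr p) \<partial>M) \<le> ennreal ((a + b) powr p)"
    unfolding int_H[symmetric] by (intro nn_integral_mono ennreal_leI H_ge)
  assume p1: "p > 1" and eq: "(\<integral>\<^sup>+x. ennreal ((f x + g x) powr p) \<partial>M) = ennreal ((a + b) powr p)"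
  have "(\<integral>\<^sup>+x. ennreal (H x - (f x + g x) powr p) \<partial>M) + ennreal ((a + b) powr p)
      = (\<integral>\<^sup>+x. ennreal (H x) \<partial>M)"
    unfolding eq[symmetric] using H_ge
    by (subst nn_integral_add[symmetric])
      (auto intro!: nn_integral_cong simp: ennreal_plus[symmetric] simp del: ennreal_plus)
  then have "(\<integral>\<^sup>+x. ennreal (H x - (f x + g x) powr p) \<partial>M) = 0"
    unfolding int_H by simp
  then have "AE x in M. ennreal (H x - (f x + g x) powr p) = 0"
    by (subst nn_integral_0_iff_AE[symmetric]) auto
  then show "AE x in M. f x * b = g x * a"
  proof eventually_elim
    case (elim x)
    then have "(f x + g x) powr p = (a + b) powr (p - 1) * (f x powr p / a powr (p - 1) + g x powr p / b powr (p - 1))"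
      using H_ge[of x] by (simp add: H_def Ka_def Kb_def algebra_simps)
    then show ?case using powr_add_le_weighted(2)[OF p a b f g p1] by simp
  qed
qed

lemma nn_integral_lborel_scaleR:
  fixes g :: "'a::euclidean_space \<Rightarrow> ennreal"
  assumes [measurable]: "g \<in> borel_measurable borel" and c: "c > 0"
  shows "(\<integral>\<^sup>+x. g x \<partial>lborel) = ennreal (c ^ DIM('a)) * (\<integral>\<^sup>+x. g (c *\<^sub>R x) \<partial>lborel)"
proof -
  have "(lborel::'a measure) = density (distr lborel borel ((*\<^sub>R) c)) (\<lambda>_. ennreal (c ^ DIM('a)))"
    using lborel_affine[of c "0::'a"] c by simp
  then have "(\<integral>\<^sup>+x. g x \<partial>lborel)
      = (\<integral>\<^sup>+x. g x \<partial>density (distr lborel borel ((*\<^sub>R) c)) (\<lambda>_. ennreal (c ^ DIM('a))))"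
    by simp
  also have "\<dots> = (\<integral>\<^sup>+x. ennreal (c ^ DIM('a)) * g (c *\<^sub>R x) \<partial>lborel)"
    by (simp add: nn_integral_density nn_integral_distr)
  also have "\<dots> = ennreal (c ^ DIM('a)) * (\<integral>\<^sup>+x. g (c *\<^sub>R x) \<partial>lborel)"
    using c by (subst nn_integral_cmult) auto
  finally show ?thesis .
qed

lemma open_empty_if_AE_notin:
  fixes U :: "'a::euclidean_space set"
  assumes U: "open U" and ae: "AE x in lborel. x \<notin> U"
  shows "U = {}"
proof -
  have "U \<in> null_sets lborel" using U ae by (subst AE_iff_null_sets) auto
  then have "negligible U" by (simp add: negligible_iff_null_sets null_sets_completionI)
  then show ?thesis using open_not_negligible U by blast
qed

lemma convex_subset_closed_if_AE:
  fixes X Y :: "'a::euclidean_space set"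
  assumes ae: "AE x in lborel. x \<in> X \<longrightarrow> x \<in> Y"
    and X: "convex X" "interior X \<noteq> {}" and Y: "closed Y"
  shows "X \<subseteq> Y"
proof -
  have "AE x in lborel. x \<notin> interior X - Y"
    using ae by eventually_elim (use interior_subset in auto)
  then have "interior X - Y = {}" using Y by (intro open_empty_if_AE_notin) auto
  then have "closure (interior X) \<subseteq> Y" using Y by (intro closure_minimal) auto
  then show ?thesis using convex_closure_interior[OF X] closure_subset by blast
qed

lemma convex_eq_if_AE_eq:
  fixes A B :: "'a::euclidean_space set"
  assumes "AE x in lborel. x \<in> A \<longleftrightarrow> x \<in> B"
    and "closed A" "convex A" "interior A \<noteq> {}" and "closed B" "convex B" "interior B \<noteq> {}"
  shows "A = B"
  using assms by (intro equalityI convex_subset_closed_if_AE) (auto elim: eventually_mono)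

section \<open>Dyadic approximation from below\<close>

definition dyadic_floor :: "nat \<Rightarrow> real \<Rightarrow> real" where
  "dyadic_floor k r = min (real k) (\<lfloor>2 ^ k * r\<rfloor> / 2 ^ k)"

lemma dyadic_floor_measurable[measurable]: "dyadic_floor k \<in> borel_measurable borel"
  unfolding dyadic_floor_def by measurable

lemma dyadic_floor_le: "dyadic_floor k r \<le> r"
proof -
  have "real_of_int \<lfloor>2 ^ k * r\<rfloor> \<le> 2 ^ k * r" by simp
  then have "real_of_int \<lfloor>2 ^ k * r\<rfloor> / 2 ^ k \<le> r" by (simp add: divide_le_eq mult.commute)
  then show ?thesis by (simp add: dyadic_floor_def min_le_iff_disj)
qed

lemma dyadic_floor_nonneg: "r \<ge> 0 \<Longrightarrow> dyadic_floor k r \<ge> 0"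
  by (simp add: dyadic_floor_def)

lemma dyadic_floor_mono: "dyadic_floor k r \<le> dyadic_floor (Suc k) r"
proof -
  have "2 * \<lfloor>2 ^ k * r\<rfloor> \<le> \<lfloor>2 ^ Suc k * r\<rfloor>" by (simp add: le_floor_iff)
  then have "2 * real_of_int \<lfloor>2 ^ k * r\<rfloor> \<le> real_of_int \<lfloor>2 ^ Suc k * r\<rfloor>"
    by (metis of_int_le_iff of_int_mult of_int_numeral)
  then have "real_of_int \<lfloor>2 ^ k * r\<rfloor> / 2 ^ k \<le> real_of_int \<lfloor>2 ^ Suc k * r\<rfloor> / 2 ^ Suc k"
    by (simp add: field_simps)
  then show ?thesis unfolding dyadic_floor_def by linarith
qed

lemma dyadic_floor_tendsto: "(\<lambda>k. dyadic_floor k r) \<longlonglongrightarrow> r"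
proof (rule real_tendsto_sandwich[of "\<lambda>k. r - 1 / 2 ^ k" _ _ "\<lambda>_. r"])
  obtain n where "r \<le> real n" using real_arch_simple by blast
  then have "eventually (\<lambda>k. r \<le> real k) sequentially"
    unfolding eventually_sequentially by (intro exI[of _ n]) (auto intro: order.trans)
  then show "eventually (\<lambda>k. r - 1 / 2 ^ k \<le> dyadic_floor k r) sequentially"
  proof (rule eventually_mono)
    fix k assume k: "r \<le> real k"
    have "(2 ^ k * r - 1) / 2 ^ k \<le> real_of_int \<lfloor>2 ^ k * r\<rfloor> / 2 ^ k"
      by (intro divide_right_mono) (linarith, simp)
    moreover have "(2 ^ k * r - 1) / 2 ^ k = r - 1 / 2 ^ k"
      by (simp add: diff_divide_distrib)
    moreover have "(0::real) \<le> 1 / 2 ^ k" by simp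
    ultimately show "r - 1 / 2 ^ k \<le> dyadic_floor k r"
      unfolding dyadic_floor_def using k by linarith
  qed
  show "eventually (\<lambda>k. dyadic_floor k r \<le> r) sequentially" by (simp add: dyadic_floor_le)
  have "(\<lambda>k. r - 1 / 2 ^ k) \<longlonglongrightarrow> r - 0"
    by (intro tendsto_intros LIMSEQ_divide_realpow_zero) auto
  then show "(\<lambda>k. r - 1 / 2 ^ k) \<longlonglongrightarrow> r" by simp
qed simp

lemma finite_dyadic_floor_image: "finite (dyadic_floor k ` {0..})"
proof (rule finite_subset)
  show "dyadic_floor k ` {0..} \<subseteq> (\<lambda>i. real_of_int i / 2 ^ k) ` {0..int (k * 2 ^ k)}"
  proof
    fix y assume "y \<in> dyadic_floor k ` {0..}"
    then obtain r where r: "r \<ge> 0" "y = dyadic_floor k r" by auto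
    have "real k = real_of_int (int (k * 2 ^ k)) / 2 ^ k" by simp
    then have "y = real_of_int (min (int (k * 2 ^ k)) \<lfloor>2 ^ k * r\<rfloor>) / 2 ^ k"
      unfolding r(2) dyadic_floor_def
      by (metis min_divide_distrib_right of_int_min zero_le_numeral zero_le_power)
    moreover have "min (int (k * 2 ^ k)) \<lfloor>2 ^ k * r\<rfloor> \<in> {0..int (k * 2 ^ k)}" using r(1) by simp
    ultimately show "y \<in> (\<lambda>i. real_of_int i / 2 ^ k) ` {0..int (k * 2 ^ k)}" by blast
  qed
qed simp

section \<open>Pseudo-cones and their radial functions\<close>

lemma pseudo_coneD:
  assumes "pseudo_cone C E"
  shows "closed E" "convex E" "0 \<notin> E" "E \<noteq> {}" "\<And>x l. x \<in> E \<Longrightarrow> l \<ge> 1 \<Longrightarrow> l *\<^sub>R x \<in> E"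
    "rec_cone E = C"
  using assms by (auto simp: pseudo_cone_def)

lemma pseudo_cone_add_cone: "pseudo_cone C E \<Longrightarrow> x \<in> C \<Longrightarrow> y \<in> E \<Longrightarrow> y + x \<in> E"
  using pseudo_coneD(6)[of C E] by (auto simp: rec_cone_def)

text \<open>Every point of a pseudo-cone is a direction of recession: z + y is the limit of
  convex combinations of z and far-out points k y of E.\<close>
lemma pseudo_cone_subset:
  assumes E: "pseudo_cone C E"
  shows "E \<subseteq> C"
proof
  fix y assume y: "y \<in> E"
  have "z + y \<in> E" if z: "z \<in> E" for z
  proof -
    define s where "s k = (1 - inverse (real (Suc k))) *\<^sub>R z + y" for k
    have "(1 - inverse (real (Suc k))) *\<^sub>R z + inverse (real (Suc k)) *\<^sub>R (real (Suc k) *\<^sub>R y) \<in> E" for k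
      using pseudo_coneD(5)[OF E y, of "real (Suc k)"]
      by (intro convexD[OF pseudo_coneD(2)[OF E] z]) (auto simp: inverse_le_1_iff)
    then have "s k \<in> E" for k by (simp add: s_def)
    moreover have "s \<longlonglongrightarrow> (1 - 0) *\<^sub>R z + y"
      unfolding s_def by (intro tendsto_intros LIMSEQ_inverse_real_of_nat)
    ultimately show "z + y \<in> E"
      using closed_sequentially[OF pseudo_coneD(1)[OF E]] by fastforce
  qed
  then show "y \<in> C" using pseudo_coneD(6)[OF E] by (auto simp: rec_cone_def)
qed

lemma pseudo_cone_norm_bounded_below:
  assumes E: "pseudo_cone C E"
  obtains d where "d > 0" "\<And>x. x \<in> E \<Longrightarrow> d \<le> norm x"
proof -
  have "open (- E)" "0 \<in> - E" using pseudo_coneD(1,3)[OF E] by auto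
  then obtain d where "d > 0" "ball 0 d \<subseteq> - E" using open_contains_ball by blast
  then show ?thesis using that by (force simp: not_le)
qed

lemma pseudo_cone_interior_nonempty:
  assumes E: "pseudo_cone C E" and C: "interior C \<noteq> {}"
  shows "interior E \<noteq> {}"
proof -
  obtain z e where e: "e > 0" "ball z e \<subseteq> C" using C mem_interior by blast
  obtain y where y: "y \<in> E" using pseudo_coneD(4)[OF E] by auto
  have "ball (y + z) e \<subseteq> E"
  proof
    fix w assume "w \<in> ball (y + z) e"
    then have "w - y \<in> C" using e by (auto simp: dist_norm algebra_simps)
    then show "w \<in> E" using pseudo_cone_add_cone[OF E _ y] by fastforce
  qed
  then show ?thesis using e interior_maximal[of "ball (y + z) e" E] by force
qed

lemma msum_scaleR_mem:
  assumes E1: "pseudo_cone C1 E1" and E2: "pseudo_cone C2 E2"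
    and x: "x \<in> msum E1 E2" and l: "l \<ge> 1"
  shows "l *\<^sub>R x \<in> msum E1 E2"
proof -
  obtain u v where uv: "u \<in> E1" "v \<in> E2" "x = u + v" using x by (auto simp: msum_def)
  have "l *\<^sub>R u \<in> E1" "l *\<^sub>R v \<in> E2" using uv l pseudo_coneD(5)[OF E1] pseudo_coneD(5)[OF E2] by auto
  then show ?thesis using uv by (auto simp: msum_def scaleR_add_right)
qed

lemma msum_dilate:
  assumes E: "convex E" and l: "l > 0"
  shows "msum E ((\<lambda>x. l *\<^sub>R x) ` E) = (\<lambda>x. (1 + l) *\<^sub>R x) ` E"
proof (intro set_eqI iffI)
  fix x assume "x \<in> msum E ((\<lambda>x. l *\<^sub>R x) ` E)"
  then obtain y z where yz: "y \<in> E" "z \<in> E" "x = y + l *\<^sub>R z" by (auto simp: msum_def)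
  have "(1 / (1 + l)) *\<^sub>R y + (l / (1 + l)) *\<^sub>R z \<in> E"
    using l yz by (intro convexD[OF E]) (auto simp: field_simps)
  moreover have "x = (1 + l) *\<^sub>R ((1 / (1 + l)) *\<^sub>R y + (l / (1 + l)) *\<^sub>R z)"
    using l yz by (simp add: scaleR_add_right)
  ultimately show "x \<in> (\<lambda>x. (1 + l) *\<^sub>R x) ` E" by blast
next
  fix x assume "x \<in> (\<lambda>x. (1 + l) *\<^sub>R x) ` E"
  then obtain y where "y \<in> E" "x = y + l *\<^sub>R y" by (auto simp: scaleR_add_left)
  then show "x \<in> msum E ((\<lambda>x. l *\<^sub>R x) ` E)" by (auto simp: msum_def)
qed

text \<open>first_hit E x is the least t > 0 with t x \<in> E, or 0 if the ray through x misses E; for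
  x \<noteq> 0 not in missed E, radial E x is the distance from 0 to E along that ray.\<close>

definition hits :: "'a::euclidean_space set \<Rightarrow> 'a \<Rightarrow> real set" where
  "hits E x = {t. t > 0 \<and> t *\<^sub>R x \<in> E}"

definition first_hit :: "'a::euclidean_space set \<Rightarrow> 'a \<Rightarrow> real" where
  "first_hit E x = (if hits E x = {} then 0 else Inf (hits E x))"

definition radial :: "'a::euclidean_space set \<Rightarrow> 'a \<Rightarrow> real" where
  "radial E x = norm x * first_hit E x"

definition missed :: "'a::euclidean_space set \<Rightarrow> 'a set" where
  "missed E = {x. hits E x = {}}"

lemma hits_up:
  assumes E: "pseudo_cone C E" and t: "t \<in> hits E x" and s: "t \<le> s"
  shows "s \<in> hits E x"
proof -
  have t0: "t > 0" "t *\<^sub>R x \<in> E" using t by (auto simp: hits_def)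
  have "(s / t) *\<^sub>R (t *\<^sub>R x) \<in> E" using pseudo_coneD(5)[OF E t0(2), of "s / t"] t0 s by simp
  moreover have "(s / t) *\<^sub>R (t *\<^sub>R x) = s *\<^sub>R x" using t0 by simp
  ultimately show ?thesis using t0 s by (simp add: hits_def)
qed

lemma first_hit_in_hits:
  assumes E: "pseudo_cone C E" and ne: "hits E x \<noteq> {}"
  shows "first_hit E x \<in> hits E x"
proof -
  obtain d where d: "d > 0" "\<And>y. y \<in> E \<Longrightarrow> d \<le> norm y"
    using pseudo_cone_norm_bounded_below[OF E] by blast
  have x0: "x \<noteq> 0" using ne pseudo_coneD(3)[OF E] by (auto simp: hits_def)
  have "hits E x = {t. d / norm x \<le> t} \<inter> (\<lambda>t. t *\<^sub>R x) -` E"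
  proof (intro set_eqI iffI)
    fix t assume t: "t \<in> hits E x"
    then have "d \<le> t * norm x" using d(2)[of "t *\<^sub>R x"] by (simp add: hits_def)
    then have "d / norm x \<le> t" using x0 by (simp add: pos_divide_le_eq mult.commute)
    then show "t \<in> {t. d / norm x \<le> t} \<inter> (\<lambda>t. t *\<^sub>R x) -` E"
      using t by (simp add: hits_def)
  next
    fix t assume "t \<in> {t. d / norm x \<le> t} \<inter> (\<lambda>t. t *\<^sub>R x) -` E"
    moreover have "d / norm x > 0" using d x0 by simp
    ultimately show "t \<in> hits E x" by (auto simp: hits_def)
  qed
  then have "closed (hits E x)"
    by (auto intro!: closed_Int closed_vimage pseudo_coneD(1)[OF E] continuous_intros closed_Collect_le)
  moreover have "bdd_below (hits E x)" by (rule bdd_belowI[of _ 0]) (auto simp: hits_def)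
  ultimately show ?thesis using closed_contains_Inf[OF ne] ne by (simp add: first_hit_def)
qed

lemma mem_hits_iff:
  assumes E: "pseudo_cone C E" and ne: "hits E x \<noteq> {}"
  shows "t \<in> hits E x \<longleftrightarrow> first_hit E x \<le> t"
proof -
  have "bdd_below (hits E x)" by (rule bdd_belowI[of _ 0]) (auto simp: hits_def)
  then show ?thesis
    using first_hit_in_hits[OF E ne] hits_up[OF E] ne by (auto simp: first_hit_def intro: cInf_lower)
qed

lemma first_hit_pos: "pseudo_cone C E \<Longrightarrow> hits E x \<noteq> {} \<Longrightarrow> first_hit E x > 0"
  using first_hit_in_hits by (fastforce simp: hits_def)

lemma first_hit_nonneg: "pseudo_cone C E \<Longrightarrow> first_hit E x \<ge> 0"
  using first_hit_pos[of C E x] by (cases "hits E x = {}") (auto simp: first_hit_def)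

lemma radial_nonneg: "pseudo_cone C E \<Longrightarrow> radial E x \<ge> 0"
  by (simp add: radial_def first_hit_nonneg)

lemma hits_scaleR: "s > 0 \<Longrightarrow> t \<in> hits E (s *\<^sub>R x) \<longleftrightarrow> t * s \<in> hits E x"
  by (auto simp: hits_def zero_less_mult_iff)

lemma hits_scaleR_empty_iff:
  assumes s: "s > 0"
  shows "hits E (s *\<^sub>R x) = {} \<longleftrightarrow> hits E x = {}"
proof
  assume empty: "hits E (s *\<^sub>R x) = {}"
  show "hits E x = {}"
  proof (rule equals0I)
    fix t assume "t \<in> hits E x"
    then have "t / s \<in> hits E (s *\<^sub>R x)" using s hits_scaleR[OF s, of "t / s" E x] by simp
    then show False using empty by simp
  qed
next
  assume "hits E x = {}"
  then show "hits E (s *\<^sub>R x) = {}" using hits_scaleR[OF s, of _ E x] by auto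
qed

lemma first_hit_scaleR:
  assumes E: "pseudo_cone C E" and s: "s > 0"
  shows "first_hit E (s *\<^sub>R x) = first_hit E x / s"
proof (cases "hits E x = {}")
  case True
  then show ?thesis using hits_scaleR_empty_iff[OF s, of E x] by (simp add: first_hit_def)
next
  case False
  then have "hits E (s *\<^sub>R x) \<noteq> {}" using hits_scaleR_empty_iff[OF s, of E x] by simp
  then have ne': "hits E (s *\<^sub>R x) \<noteq> {}" .
  have "first_hit E (s *\<^sub>R x) \<le> t \<longleftrightarrow> first_hit E x / s \<le> t" for t
  proof -
    have "first_hit E (s *\<^sub>R x) \<le> t \<longleftrightarrow> t \<in> hits E (s *\<^sub>R x)"
      using mem_hits_iff[OF E ne'] by simp
    also have "\<dots> \<longleftrightarrow> first_hit E x \<le> t * s"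
      by (simp add: hits_scaleR[OF s] mem_hits_iff[OF E False])
    also have "\<dots> \<longleftrightarrow> first_hit E x / s \<le> t"
      using s by (simp add: divide_le_eq)
    finally show ?thesis .
  qed
  then show ?thesis by (meson antisym order_refl)
qed

lemma radial_scaleR: "pseudo_cone C E \<Longrightarrow> s > 0 \<Longrightarrow> radial E (s *\<^sub>R x) = radial E x"
  by (simp add: radial_def first_hit_scaleR)

lemma mem_iff_first_hit_le_1:
  "pseudo_cone C E \<Longrightarrow> hits E x \<noteq> {} \<Longrightarrow> x \<in> E \<longleftrightarrow> first_hit E x \<le> 1"
  using mem_hits_iff[of C E x 1] by (simp add: hits_def)

lemma mem_dilate_iff_first_hit:
  assumes E: "pseudo_cone C E" and c: "c > 0" and ne: "hits E x \<noteq> {}"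
  shows "x \<in> (\<lambda>y. c *\<^sub>R y) ` E \<longleftrightarrow> c * first_hit E x \<le> 1"
proof -
  have "x \<in> (\<lambda>y. c *\<^sub>R y) ` E \<longleftrightarrow> inverse c *\<^sub>R x \<in> E"
    using c by (auto intro: image_eqI[of _ _ "inverse c *\<^sub>R x"])
  also have "\<dots> \<longleftrightarrow> first_hit E (inverse c *\<^sub>R x) \<le> 1"
    using c ne hits_scaleR_empty_iff[of "inverse c" E x] by (intro mem_iff_first_hit_le_1[OF E]) auto
  finally show ?thesis using c by (simp add: first_hit_scaleR[OF E] divide_inverse_commute)
qed

lemma missed_notin:
  assumes "x \<in> missed E"
  shows "x \<notin> E"
proof
  assume "x \<in> E"
  then have "1 \<in> hits E x" by (simp add: hits_def)
  then show False using assms by (simp add: missed_def)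
qed

lemma notin_pseudo_cone_iff:
  assumes E: "pseudo_cone C E" and x: "x \<noteq> 0"
  shows "x \<notin> E \<longleftrightarrow> x \<in> missed E \<or> norm x < radial E x"
proof (cases "x \<in> missed E")
  case False
  then have "x \<in> E \<longleftrightarrow> first_hit E x \<le> 1"
    by (intro mem_iff_first_hit_le_1[OF E]) (simp add: missed_def)
  also have "\<dots> \<longleftrightarrow> norm x * first_hit E x \<le> norm x"
    using x by (simp add: mult_le_cancel_left1)
  finally show ?thesis using False by (simp add: radial_def not_le)
qed (simp add: missed_notin)

lemma norm_less_radial_add:
  assumes E1: "pseudo_cone C1 E1" and E2: "pseudo_cone C2 E2"
    and x: "x \<noteq> 0" "x \<notin> msum E1 E2" "x \<notin> missed E1" "x \<notin> missed E2"
  shows "norm x < radial E1 x + radial E2 x"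
proof (rule ccontr)
  have ne: "hits E1 x \<noteq> {}" "hits E2 x \<noteq> {}" using x by (auto simp: missed_def)
  define r where "r = first_hit E1 x + first_hit E2 x"
  have "first_hit E1 x *\<^sub>R x \<in> E1" "first_hit E2 x *\<^sub>R x \<in> E2"
    using first_hit_in_hits[OF E1 ne(1)] first_hit_in_hits[OF E2 ne(2)] by (auto simp: hits_def)
  then have sum: "r *\<^sub>R x \<in> msum E1 E2" by (auto simp: r_def msum_def scaleR_add_left)
  have r: "r > 0" using first_hit_pos[OF E1 ne(1)] first_hit_pos[OF E2 ne(2)] by (simp add: r_def)
  assume "\<not> norm x < radial E1 x + radial E2 x"
  then have "norm x * r \<le> norm x * 1" by (simp add: radial_def r_def algebra_simps)
  then have "1 \<le> inverse r" using r x by (simp add: one_le_inverse_iff)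
  then have "inverse r *\<^sub>R (r *\<^sub>R x) \<in> msum E1 E2" by (rule msum_scaleR_mem[OF E1 E2 sum])
  then show False using r x by simp
qed

lemma hits_nonempty_eq:
  assumes E: "pseudo_cone C E"
  shows "{x. hits E x \<noteq> {}} = (\<Union>n. {x. real (Suc n) *\<^sub>R x \<in> E})"
proof -
  have "hits E x \<noteq> {} \<longleftrightarrow> (\<exists>n. real (Suc n) \<in> hits E x)" for x
  proof
    assume "hits E x \<noteq> {}"
    then obtain t where t: "t \<in> hits E x" by auto
    obtain n where "t \<le> real n" using real_arch_simple by blast
    then show "\<exists>n. real (Suc n) \<in> hits E x" using hits_up[OF E t] by (intro exI[of _ n]) simp
  qed auto
  then show ?thesis by (auto simp: hits_def)
qed

lemma missed_borel[measurable]: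
  assumes E: "pseudo_cone C E"
  shows "missed E \<in> sets borel"
proof -
  have [measurable]: "E \<in> sets borel" using pseudo_coneD(1)[OF E] by (simp add: borel_closed)
  have "missed E = - (\<Union>n. {x. real (Suc n) *\<^sub>R x \<in> E})"
    using hits_nonempty_eq[OF E] by (auto simp: missed_def)
  also have "\<dots> \<in> sets borel" by measurable
  finally show ?thesis .
qed

lemma first_hit_borel_measurable:
  assumes E: "pseudo_cone C E"
  shows "first_hit E \<in> borel_measurable borel"
proof (rule borel_measurableI_le)
  fix y :: real
  have [measurable]: "E \<in> sets borel" "missed E \<in> sets borel"
    using pseudo_coneD(1)[OF E] missed_borel[OF E] by (simp_all add: borel_closed)
  have "{x. first_hit E x \<le> y} = (if y < 0 then {} else missed E \<union> {x. 0 < y \<and> y *\<^sub>R x \<in> E})"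
  proof (cases "y < 0")
    case True
    then show ?thesis using first_hit_nonneg[OF E] by (auto simp: not_le intro: less_le_trans)
  next
    case False
    have "first_hit E x \<le> y \<longleftrightarrow> x \<in> missed E \<or> (0 < y \<and> y *\<^sub>R x \<in> E)" for x
    proof (cases "x \<in> missed E")
      case True
      then show ?thesis using False by (simp add: missed_def first_hit_def)
    next
      case not_missed: False
      then have ne: "hits E x \<noteq> {}" by (simp add: missed_def)
      show ?thesis using mem_hits_iff[OF E ne, of y] not_missed by (auto simp: hits_def)
    qed
    then show ?thesis using False by auto
  qed
  also have "\<dots> \<in> sets borel"
  proof -
    have "missed E \<union> {x. 0 < y \<and> y *\<^sub>R x \<in> E} \<in> sets borel" by measurable
    then show ?thesis by simp
  qed
  finally show "{x \<in> space borel. first_hit E x \<le> y} \<in> sets borel" by simp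
qed

lemma radial_borel_measurable[measurable]:
  "pseudo_cone C E \<Longrightarrow> radial E \<in> borel_measurable borel"
  using first_hit_borel_measurable unfolding radial_def by measurable

section \<open>Integration against a homogeneous weight\<close>

lemma SUP_indicator_ennreal: "(SUP i. indicator (A i) x :: ennreal) = indicator (\<Union>i. A i) x"
proof (cases "\<exists>i. x \<in> A i")
  case True
  then obtain i where "x \<in> A i" by blast
  then have "1 \<le> (SUP i. indicator (A i) x :: ennreal)" by (intro SUP_upper2[of i]) auto
  moreover have "(SUP i. indicator (A i) x :: ennreal) \<le> 1" by (intro SUP_least) (simp add: indicator_def)
  ultimately show ?thesis using True by (auto simp: indicator_def)
qed (simp add: indicator_def)

locale homogeneous_weight =
  fixes C :: "'a::euclidean_space set" and \<Theta> :: "'a \<Rightarrow> real" and q :: real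
  assumes pointed: "pointed_cone C" and q_le: "q \<le> real DIM('a) - 1"
    and continuous: "continuous_on (C - {0}) \<Theta>"
    and positive: "\<And>x. x \<in> C - {0} \<Longrightarrow> \<Theta> x > 0"
    and homogeneous: "\<And>x t. x \<in> C - {0} \<Longrightarrow> t > 0 \<Longrightarrow> \<Theta> (t *\<^sub>R x) = t powr (- q) * \<Theta> x"
begin

definition p :: real where "p = real DIM('a) - q"

definition weight :: "'a \<Rightarrow> ennreal" where
  "weight x = ennreal (\<Theta> x) * indicator (C - {0}) x"

definition scale_invariant :: "('a \<Rightarrow> 'b) \<Rightarrow> bool" where
  "scale_invariant g \<longleftrightarrow> (\<forall>x\<in>C - {0}. \<forall>t>0. g (t *\<^sub>R x) = g x)"

lemma p_ge_1: "p \<ge> 1"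
  using q_le by (simp add: p_def)

lemma scaleR_mem_C_iff:
  assumes t: "t > 0"
  shows "t *\<^sub>R x \<in> C - {0} \<longleftrightarrow> x \<in> C - {0}"
proof -
  have scale: "s *\<^sub>R y \<in> C - {0}" if "y \<in> C - {0}" "s > 0" for s y
    using that pointed by (auto simp: pointed_cone_def cone_def)
  show ?thesis using scale[of x t] scale[of "t *\<^sub>R x" "inverse t"] t by auto
qed

lemma weight_measurable[measurable]: "weight \<in> borel_measurable borel"
proof -
  have C_borel: "C - {0} \<in> sets borel"
    using pointed by (intro sets.Diff) (auto simp: pointed_cone_def intro: borel_closed)
  have "(\<lambda>x. indicator (C - {0}) x *\<^sub>R \<Theta> x) \<in> borel_measurable borel"
    using continuous C_borel by (intro borel_measurable_continuous_on_indicator)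
  then have "(\<lambda>x. ennreal (indicator (C - {0}) x *\<^sub>R \<Theta> x)) \<in> borel_measurable borel"
    by measurable
  also have "(\<lambda>x. ennreal (indicator (C - {0}) x *\<^sub>R \<Theta> x)) = weight"
    by (auto simp: weight_def fun_eq_iff indicator_def)
  finally show ?thesis .
qed

lemma weight_scaleR: "t > 0 \<Longrightarrow> weight (t *\<^sub>R x) = ennreal (t powr (- q)) * weight x"
  using positive[of x] homogeneous[of x t] scaleR_mem_C_iff[of t x]
  by (cases "x \<in> C - {0}") (auto simp: weight_def ennreal_mult)

lemma weight_pos: "x \<in> C - {0} \<Longrightarrow> weight x > 0"
  using positive by (simp add: weight_def)

lemma weight_eq_0: "x \<notin> C - {0} \<Longrightarrow> weight x = 0"
  by (simp add: weight_def)

lemma nn_integral_weight_scaleR: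
  assumes [measurable]: "f \<in> borel_measurable borel" and c: "c > 0"
  shows "(\<integral>\<^sup>+x. weight x * f x \<partial>lborel) = ennreal (c powr p) * (\<integral>\<^sup>+x. weight x * f (c *\<^sub>R x) \<partial>lborel)"
proof -
  have "(\<integral>\<^sup>+x. weight x * f x \<partial>lborel)
      = ennreal (c ^ DIM('a)) * (\<integral>\<^sup>+x. ennreal (c powr (- q)) * (weight x * f (c *\<^sub>R x)) \<partial>lborel)"
    using c by (subst nn_integral_lborel_scaleR[of _ c]) (auto simp: weight_scaleR mult.assoc)
  also have "\<dots> = ennreal (c ^ DIM('a) * c powr (- q)) * (\<integral>\<^sup>+x. weight x * f (c *\<^sub>R x) \<partial>lborel)"
    using c by (simp add: nn_integral_cmult ennreal_mult mult.assoc)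
  also have "c ^ DIM('a) * c powr (- q) = c powr p"
    using c by (simp add: p_def powr_realpow[symmetric] powr_add[symmetric])
  finally show ?thesis .
qed

lemma nn_integral_weight_norm_less:
  fixes g :: "'a \<Rightarrow> ennreal"
  assumes [measurable]: "g \<in> borel_measurable borel" and g: "scale_invariant g" and c: "c \<ge> 0"
  shows "(\<integral>\<^sup>+x. weight x * g x * indicator {x. norm x < c} x \<partial>lborel)
       = ennreal (c powr p) * (\<integral>\<^sup>+x. weight x * g x * indicator {x. norm x < 1} x \<partial>lborel)"
proof (cases "c = 0")
  case False
  then have c: "c > 0" using c by simp
  have "(\<integral>\<^sup>+x. weight x * g x * indicator {x. norm x < c} x \<partial>lborel)
      = ennreal (c powr p) * (\<integral>\<^sup>+x. weight x * (g (c *\<^sub>R x) * indicator {x. norm x < c} (c *\<^sub>R x)) \<partial>lborel)"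
    using c by (subst nn_integral_weight_scaleR[symmetric]) (auto simp: mult.assoc)
  also have "(\<integral>\<^sup>+x. weight x * (g (c *\<^sub>R x) * indicator {x. norm x < c} (c *\<^sub>R x)) \<partial>lborel)
      = (\<integral>\<^sup>+x. weight x * g x * indicator {x. norm x < 1} x \<partial>lborel)"
  proof (intro nn_integral_cong)
    fix x
    show "weight x * (g (c *\<^sub>R x) * indicator {x. norm x < c} (c *\<^sub>R x))
        = weight x * g x * indicator {x. norm x < 1} x"
    proof (cases "x \<in> C - {0}")
      case True
      then have "g (c *\<^sub>R x) = g x" using g c by (simp add: scale_invariant_def)
      then show ?thesis using c by (simp add: indicator_def mult.assoc)
    qed (simp add: weight_eq_0)
  qed
  finally show ?thesis .
qed simp

lemma nn_integral_weight_eq_0_if_ball: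
  fixes g :: "'a \<Rightarrow> ennreal"
  assumes [measurable]: "g \<in> borel_measurable borel" and g: "scale_invariant g"
    and ball: "(\<integral>\<^sup>+x. weight x * g x * indicator {x. norm x < 1} x \<partial>lborel) = 0"
  shows "(\<integral>\<^sup>+x. weight x * g x \<partial>lborel) = 0"
proof -
  have "(\<integral>\<^sup>+x. weight x * g x * indicator {x. norm x < real n} x \<partial>lborel) = 0" for n :: nat
    using nn_integral_weight_norm_less[OF _ g, of "real n"] ball by simp
  then have "\<forall>n::nat. AE x in lborel. weight x * g x * indicator {x. norm x < real n} x = 0"
    by (subst (asm) nn_integral_0_iff_AE) auto
  then have "AE x in lborel. \<forall>n::nat. weight x * g x * indicator {x. norm x < real n} x = 0"
    by (rule AE_all_countable[THEN iffD2])
  then have "AE x in lborel. weight x * g x = 0"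
  proof eventually_elim
    case (elim x)
    obtain n :: nat where "norm x < real n" using reals_Archimedean2 by blast
    then show ?case using elim[rule_format, of n] by (simp add: indicator_def)
  qed
  then show ?thesis by (subst nn_integral_0_iff_AE) auto
qed

text \<open>A finite integral over the whole cone dominates the integrals over all the balls
  of radius c, which grow like c powr p.\<close>
lemma nn_integral_weight_ball_eq_0:
  fixes g :: "'a \<Rightarrow> ennreal"
  assumes [measurable]: "g \<in> borel_measurable borel" and g: "scale_invariant g"
    and finite: "(\<integral>\<^sup>+x. weight x * g x \<partial>lborel) < \<infinity>"
  shows "(\<integral>\<^sup>+x. weight x * g x * indicator {x. norm x < 1} x \<partial>lborel) = 0"
proof (rule ccontr)
  define I where "I = (\<integral>\<^sup>+x. weight x * g x * indicator {x. norm x < 1} x \<partial>lborel)"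
  define B where "B = (\<integral>\<^sup>+x. weight x * g x \<partial>lborel)"
  assume "(\<integral>\<^sup>+x. weight x * g x * indicator {x. norm x < 1} x \<partial>lborel) \<noteq> 0"
  then have "I \<noteq> 0" by (simp add: I_def)
  have le: "ennreal (c powr p) * I \<le> B" if "c > 0" for c
  proof -
    have "ennreal (c powr p) * I = (\<integral>\<^sup>+x. weight x * g x * indicator {x. norm x < c} x \<partial>lborel)"
      unfolding I_def using nn_integral_weight_norm_less[OF _ g, of c] that by simp
    also have "\<dots> \<le> B" unfolding B_def by (intro nn_integral_mono) (auto simp: indicator_def)
    finally show ?thesis .
  qed
  obtain b where b: "B = ennreal b" "b \<ge> 0" using finite by (cases B) (auto simp: B_def)
  obtain i where i: "I = ennreal i" "i > 0"
    using le[of 1] b \<open>I \<noteq> 0\<close> by (cases I) (auto simp: top_unique)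
  define c where "c = ((b + 1) / i) powr (1 / p)"
  have "c > 0" "c powr p = (b + 1) / i" using i b p_ge_1 by (simp_all add: c_def powr_powr)
  then have "ennreal (b + 1) \<le> ennreal b"
    using le[of c] i b by (simp add: ennreal_mult[symmetric])
  then show False using b by (simp add: ennreal_le_iff)
qed

lemma nn_integral_weight_norm_less_finite_range:
  fixes R :: "'a \<Rightarrow> real"
  assumes [measurable]: "R \<in> borel_measurable borel" and R_nonneg: "\<And>x. R x \<ge> 0"
    and R: "scale_invariant R" and fin: "finite (range R)"
  shows "(\<integral>\<^sup>+x. weight x * indicator {x. norm x < R x} x \<partial>lborel)
       = (\<integral>\<^sup>+x. weight x * indicator {x. norm x < 1} x * ennreal (R x powr p) \<partial>lborel)"
proof -
  have level_invariant: "scale_invariant (indicator {x. R x = v} :: 'a \<Rightarrow> ennreal)" for v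
    using R by (simp add: scale_invariant_def indicator_def)
  have pick: "(\<Sum>v\<in>range R. indicator {x. R x = v} x * F v) = F (R x)" for x and F :: "real \<Rightarrow> ennreal"
  proof -
    have "(\<Sum>v\<in>range R. indicator {x. R x = v} x * F v) = (\<Sum>v\<in>range R. if R x = v then F v else 0)"
      by (intro sum.cong) (auto simp: indicator_def)
    then show ?thesis using fin by (simp add: sum.delta)
  qed
  have "(\<integral>\<^sup>+x. weight x * indicator {x. norm x < R x} x \<partial>lborel)
      = (\<integral>\<^sup>+x. (\<Sum>v\<in>range R. indicator {x. R x = v} x * (weight x * indicator {x. norm x < v} x)) \<partial>lborel)"
    by (intro nn_integral_cong) (subst pick, simp add: indicator_def)
  also have "\<dots> = (\<Sum>v\<in>range R. \<integral>\<^sup>+x. weight x * indicator {x. R x = v} x * indicator {x. norm x < v} x \<partial>lborel)"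
    by (subst nn_integral_sum) (auto simp: mult_ac)
  also have "\<dots> = (\<Sum>v\<in>range R. ennreal (v powr p)
      * (\<integral>\<^sup>+x. weight x * indicator {x. R x = v} x * indicator {x. norm x < 1} x \<partial>lborel))"
    using R_nonneg by (intro sum.cong refl nn_integral_weight_norm_less level_invariant) auto
  also have "\<dots> = (\<Sum>v\<in>range R. \<integral>\<^sup>+x. indicator {x. R x = v} x
      * (weight x * indicator {x. norm x < 1} x * ennreal (v powr p)) \<partial>lborel)"
    by (intro sum.cong refl, subst nn_integral_cmult[symmetric]) (auto intro!: nn_integral_cong simp: mult_ac)
  also have "\<dots> = (\<integral>\<^sup>+x. weight x * indicator {x. norm x < 1} x * ennreal (R x powr p) \<partial>lborel)"
    by (subst nn_integral_sum[symmetric]) (auto simp: pick)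
  finally show ?thesis .
qed

text \<open>Approximate R from below by functions with finitely many values, on whose level sets the
  previous lemma applies, and pass to the limit by monotone convergence.\<close>
lemma nn_integral_weight_norm_less_radial:
  fixes R :: "'a \<Rightarrow> real"
  assumes [measurable]: "R \<in> borel_measurable borel" and R_nonneg: "\<And>x. R x \<ge> 0"
    and R: "scale_invariant R"
  shows "(\<integral>\<^sup>+x. weight x * indicator {x. norm x < R x} x \<partial>lborel)
       = (\<integral>\<^sup>+x. weight x * indicator {x. norm x < 1} x * ennreal (R x powr p) \<partial>lborel)"
proof -
  define Rk where "Rk k x = dyadic_floor k (R x)" for k x
  have [measurable]: "Rk k \<in> borel_measurable borel" for k unfolding Rk_def by measurable
  have Rk_nonneg: "Rk k x \<ge> 0" for k x using R_nonneg by (simp add: Rk_def dyadic_floor_nonneg)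
  have Rk_mono: "Rk k x \<le> Rk (Suc k) x" for k x by (simp add: Rk_def dyadic_floor_mono)
  have Rk_le: "Rk k x \<le> R x" for k x by (simp add: Rk_def dyadic_floor_le)
  have Rk_lim: "(\<lambda>k. Rk k x) \<longlonglongrightarrow> R x" for x by (simp add: Rk_def dyadic_floor_tendsto)
  have Rk_finite: "(\<integral>\<^sup>+x. weight x * indicator {x. norm x < Rk k x} x \<partial>lborel)
      = (\<integral>\<^sup>+x. weight x * indicator {x. norm x < 1} x * ennreal (Rk k x powr p) \<partial>lborel)" for k
  proof (rule nn_integral_weight_norm_less_finite_range)
    show "scale_invariant (Rk k)" using R by (simp add: scale_invariant_def Rk_def)
    have "range (Rk k) \<subseteq> dyadic_floor k ` {0..}" using R_nonneg by (auto simp: Rk_def)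
    then show "finite (range (Rk k))" using finite_dyadic_floor_image finite_subset by blast
  qed (auto simp: Rk_nonneg)
  have union: "(\<Union>k. {x. norm x < Rk k x}) = {x. norm x < R x}"
  proof (intro set_eqI iffI)
    fix x assume "x \<in> {x. norm x < R x}"
    then have "eventually (\<lambda>k. norm x < Rk k x) sequentially"
      using Rk_lim[of x] by (simp add: order_tendsto_iff)
    then obtain k where "norm x < Rk k x" by (auto simp: eventually_sequentially)
    then show "x \<in> (\<Union>k. {x. norm x < Rk k x})" by blast
  qed (auto intro: less_le_trans Rk_le)
  have powr_SUP: "(SUP k. ennreal (Rk k x powr p)) = ennreal (R x powr p)" for x
  proof -
    have "incseq (\<lambda>k. ennreal (Rk k x powr p))"
      using Rk_mono Rk_nonneg p_ge_1 by (intro incseq_SucI ennreal_leI powr_mono2) auto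
    moreover have "(\<lambda>k. ennreal (Rk k x powr p)) \<longlonglongrightarrow> ennreal (R x powr p)"
      using Rk_lim Rk_nonneg p_ge_1 by (intro tendsto_ennrealI tendsto_powr') auto
    ultimately show ?thesis using LIMSEQ_SUP LIMSEQ_unique by blast
  qed
  have "(\<integral>\<^sup>+x. weight x * indicator {x. norm x < R x} x \<partial>lborel)
      = (\<integral>\<^sup>+x. (SUP k. weight x * indicator {x. norm x < Rk k x} x) \<partial>lborel)"
    by (simp add: SUP_mult_left_ennreal[symmetric] SUP_indicator_ennreal union)
  also have "\<dots> = (SUP k. \<integral>\<^sup>+x. weight x * indicator {x. norm x < Rk k x} x \<partial>lborel)"
    using Rk_mono
    by (intro nn_integral_monotone_convergence_SUP incseq_SucI le_funI mult_left_mono)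
      (auto simp: indicator_def intro: less_le_trans)
  also have "\<dots> = (SUP k. \<integral>\<^sup>+x. weight x * indicator {x. norm x < 1} x * ennreal (Rk k x powr p) \<partial>lborel)"
    by (simp add: Rk_finite)
  also have "\<dots> = (\<integral>\<^sup>+x. (SUP k. weight x * indicator {x. norm x < 1} x * ennreal (Rk k x powr p)) \<partial>lborel)"
    using Rk_mono Rk_nonneg p_ge_1
    by (intro nn_integral_monotone_convergence_SUP[symmetric] incseq_SucI le_funI mult_left_mono
        ennreal_leI powr_mono2) auto
  also have "\<dots> = (\<integral>\<^sup>+x. weight x * indicator {x. norm x < 1} x * ennreal (R x powr p) \<partial>lborel)"
    by (simp add: SUP_mult_left_ennreal[symmetric] powr_SUP)
  finally show ?thesis .
qed

section \<open>The covolume inequality\<close>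

definition wcovol :: "'a set \<Rightarrow> ennreal" where
  "wcovol E = (\<integral>\<^sup>+x. weight x * indicator (- E) x \<partial>lborel)"

lemma covol_eq_wcovol: "covol C \<Theta> E = wcovol E"
proof -
  have "covol C \<Theta> E = (\<integral>\<^sup>+x. ennreal (\<Theta> x) * indicator (C - E) x \<partial>lborel)"
    unfolding covol_def by (simp add: nn_integral_completion)
  also have "\<dots> = wcovol E"
    unfolding wcovol_def using AE_lborel_singleton[of 0]
    by (intro nn_integral_cong_AE) (auto simp: weight_def indicator_def elim!: eventually_mono)
  finally show ?thesis .
qed

lemma wcovol_dilate:
  assumes E: "closed E" and c: "c > 0"
  shows "wcovol ((\<lambda>x. c *\<^sub>R x) ` E) = ennreal (c powr p) * wcovol E"
proof -
  have [measurable]: "(\<lambda>x. c *\<^sub>R x) ` E \<in> sets borel"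
    using closed_scaling[OF E] by (simp add: borel_closed)
  have "c *\<^sub>R x \<in> (\<lambda>x. c *\<^sub>R x) ` E \<longleftrightarrow> x \<in> E" for x using c by auto
  then show ?thesis
    unfolding wcovol_def using c by (subst nn_integral_weight_scaleR[of _ c]) (auto simp: indicator_def)
qed

lemma AE_not_missed:
  assumes E: "pseudo_cone C E" and finite: "wcovol E < \<infinity>"
  shows "AE x in lborel. x \<in> C - {0} \<longrightarrow> x \<notin> missed E"
proof -
  have [measurable]: "missed E \<in> sets borel" by (rule missed_borel[OF E])
  have "scale_invariant (indicator (missed E) :: 'a \<Rightarrow> ennreal)"
    by (simp add: scale_invariant_def indicator_def missed_def hits_scaleR_empty_iff)
  moreover have "(\<integral>\<^sup>+x. weight x * indicator (missed E) x \<partial>lborel) \<le> wcovol E"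
    unfolding wcovol_def using missed_notin
    by (intro nn_integral_mono) (auto simp: indicator_def)
  ultimately have "(\<integral>\<^sup>+x. weight x * indicator (missed E) x \<partial>lborel) = 0"
    using finite by (intro nn_integral_weight_eq_0_if_ball nn_integral_weight_ball_eq_0) auto
  then have "AE x in lborel. weight x * indicator (missed E) x = 0"
    by (subst (asm) nn_integral_0_iff_AE) auto
  then show ?thesis by eventually_elim (use weight_pos in \<open>fastforce simp: indicator_def\<close>)
qed

lemma wcovol_eq_radial:
  assumes E: "pseudo_cone C E" and finite: "wcovol E < \<infinity>"
  shows "wcovol E = (\<integral>\<^sup>+x. weight x * indicator {x. norm x < 1} x * ennreal (radial E x powr p) \<partial>lborel)"
proof -
  have "wcovol E = (\<integral>\<^sup>+x. weight x * indicator {x. norm x < radial E x} x \<partial>lborel)"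
    unfolding wcovol_def using AE_not_missed[OF E finite]
  proof (intro nn_integral_cong_AE, eventually_elim)
    case (elim x)
    then show ?case
      using notin_pseudo_cone_iff[OF E, of x] by (cases "x \<in> C - {0}") (auto simp: weight_eq_0 indicator_def)
  qed
  also have "\<dots> = (\<integral>\<^sup>+x. weight x * indicator {x. norm x < 1} x * ennreal (radial E x powr p) \<partial>lborel)"
    using E by (intro nn_integral_weight_norm_less_radial)
      (auto simp: radial_nonneg scale_invariant_def radial_scaleR)
  finally show ?thesis .
qed

text \<open>The region between 0 and E inside the cone contains a small ball, on which the weight
  is positive.\<close>
lemma wcovol_pos:
  assumes E: "pseudo_cone C E"
  shows "wcovol E > 0"
proof (rule ccontr)
  have [measurable]: "E \<in> sets borel" using pseudo_coneD(1)[OF E] by (simp add: borel_closed)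
  assume "\<not> wcovol E > 0"
  then have "(\<integral>\<^sup>+x. weight x * indicator (- E) x \<partial>lborel) = 0" by (simp add: wcovol_def)
  then have "AE x in lborel. weight x * indicator (- E) x = 0"
    by (subst (asm) nn_integral_0_iff_AE) auto
  then have AE_in_E: "AE x in lborel. x \<in> C - {0} \<longrightarrow> x \<in> E"
    by eventually_elim (use weight_pos in \<open>fastforce simp: indicator_def\<close>)
  obtain d where d: "d > 0" "\<And>x. x \<in> E \<Longrightarrow> d \<le> norm x"
    using pseudo_cone_norm_bounded_below[OF E] by blast
  obtain z where "z \<in> interior C" using pointed by (auto simp: pointed_cone_def)
  then obtain e where e: "e > 0" "ball z e \<subseteq> C" using mem_interior by blast
  have ze: "norm z + e > 0" using e by (simp add: add_nonneg_pos)
  define s where "s = d / (2 * (norm z + e))"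
  have s: "s > 0" using d ze by (simp add: s_def)
  define U where "U = (\<lambda>x. s *\<^sub>R x) ` ball z e"
  have U_C: "U \<subseteq> C" using e s pointed by (auto simp: U_def pointed_cone_def cone_def)
  have U_small: "norm w < d" if "w \<in> U" for w
  proof -
    obtain y where y: "dist z y < e" "w = s *\<^sub>R y" using \<open>w \<in> U\<close> by (auto simp: U_def)
    have "norm y < norm z + e" using y(1) norm_triangle_sub[of y z] by (simp add: dist_norm norm_minus_commute)
    then have "norm w < s * (norm z + e)" using s y(2) by simp
    also have "\<dots> = d / 2" using ze by (simp add: s_def field_simps)
    finally show ?thesis using d by simp
  qed
  have "AE x in lborel. x \<notin> U"
    using AE_in_E AE_lborel_singleton[of 0] by eventually_elim (use U_C U_small d in fastforce)
  moreover have "open U" "U \<noteq> {}" using s e by (auto simp: U_def open_scaling)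
  ultimately show False using open_empty_if_AE_notin by blast
qed

lemma wcovol_msum_le_radial:
  assumes E1: "pseudo_cone C E1" and E2: "pseudo_cone C E2"
    and f1: "wcovol E1 < \<infinity>" and f2: "wcovol E2 < \<infinity>"
  shows "wcovol (msum E1 E2) \<le> (\<integral>\<^sup>+x. weight x * indicator {x. norm x < 1} x
           * ennreal ((radial E1 x + radial E2 x) powr p) \<partial>lborel)"
proof -
  have [measurable]: "radial E1 \<in> borel_measurable borel" "radial E2 \<in> borel_measurable borel"
    using E1 E2 by (simp_all add: radial_borel_measurable)
  have "wcovol (msum E1 E2) \<le> (\<integral>\<^sup>+x. weight x * indicator {x. norm x < radial E1 x + radial E2 x} x \<partial>lborel)"
    unfolding wcovol_def using AE_not_missed[OF E1 f1] AE_not_missed[OF E2 f2]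
  proof (intro nn_integral_mono_AE, eventually_elim)
    case (elim x)
    show ?case
    proof (cases "x \<in> C - {0} \<and> x \<notin> msum E1 E2")
      case True
      then show ?thesis using elim norm_less_radial_add[OF E1 E2, of x] by (auto simp: indicator_def)
    qed (auto simp: weight_eq_0 indicator_def)
  qed
  also have "\<dots> = (\<integral>\<^sup>+x. weight x * indicator {x. norm x < 1} x
      * ennreal ((radial E1 x + radial E2 x) powr p) \<partial>lborel)"
    using E1 E2 by (intro nn_integral_weight_norm_less_radial)
      (auto simp: radial_nonneg add_nonneg_nonneg scale_invariant_def radial_scaleR)
  finally show ?thesis .
qed

text \<open>If the radial functions are proportional on almost all of the unit ball of the cone, then by
  scale invariance they are proportional almost everywhere, so the two closed convex sets agree
  almost everywhere up to dilation.\<close>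
lemma dilate_if_AE_radial_proportional:
  assumes E1: "pseudo_cone C E1" and E2: "pseudo_cone C E2"
    and f1: "wcovol E1 < \<infinity>" and f2: "wcovol E2 < \<infinity>" and a: "a > 0" and b: "b > 0"
    and ae: "AE x in lborel. 0 < weight x * indicator {x. norm x < 1} x \<longrightarrow>
               radial E1 x * b = radial E2 x * a"
  shows "E2 = (\<lambda>x. (b / a) *\<^sub>R x) ` E1"
proof -
  define c where "c = b / a"
  have c: "c > 0" using a b by (simp add: c_def)
  define D where "D = {x. radial E1 x * b \<noteq> radial E2 x * a}"
  have [measurable]: "D \<in> sets borel"
    using E1 E2 radial_borel_measurable unfolding D_def by measurable
  have "scale_invariant (indicator D :: 'a \<Rightarrow> ennreal)"
    using E1 E2 by (simp add: scale_invariant_def D_def indicator_def radial_scaleR)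
  moreover have "(\<integral>\<^sup>+x. weight x * indicator D x * indicator {x. norm x < 1} x \<partial>lborel) = 0"
  proof (subst nn_integral_0_iff_AE)
    show "AE x in lborel. weight x * indicator D x * indicator {x. norm x < 1} x = 0"
      using ae by eventually_elim (auto simp: D_def indicator_def)
  qed measurable
  ultimately have "(\<integral>\<^sup>+x. weight x * indicator D x \<partial>lborel) = 0"
    by (intro nn_integral_weight_eq_0_if_ball) auto
  then have "AE x in lborel. weight x * indicator D x = 0"
    by (subst (asm) nn_integral_0_iff_AE) auto
  then have "AE x in lborel. x \<in> E2 \<longleftrightarrow> x \<in> (\<lambda>x. c *\<^sub>R x) ` E1"
    using AE_not_missed[OF E1 f1] AE_not_missed[OF E2 f2]
  proof eventually_elim
    case (elim x)
    show ?case
    proof (cases "x \<in> C - {0}")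
      case False
      have "E2 \<subseteq> C - {0}" using pseudo_cone_subset[OF E2] pseudo_coneD(3)[OF E2] by auto
      moreover have "c *\<^sub>R y \<in> C - {0}" if "y \<in> E1" for y
        using that pseudo_cone_subset[OF E1] pseudo_coneD(3)[OF E1] scaleR_mem_C_iff[OF c, of y] by auto
      ultimately show ?thesis using False by blast
    next
      case True
      with elim weight_pos[OF True] have ne: "hits E1 x \<noteq> {}" "hits E2 x \<noteq> {}" and "x \<notin> D"
        by (auto simp: missed_def indicator_def)
      then have "first_hit E2 x = c * first_hit E1 x"
        using True a by (simp add: D_def radial_def c_def field_simps)
      then show ?thesis
        using mem_iff_first_hit_le_1[OF E2 ne(2)] mem_dilate_iff_first_hit[OF E1 c ne(1)] by simp
    qed
  qed
  moreover have "interior ((\<lambda>x. c *\<^sub>R x) ` E1) \<noteq> {}"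
  proof -
    have "interior ((\<lambda>x. c *\<^sub>R x) ` E1) = (\<lambda>x. c *\<^sub>R x) ` interior E1"
      using c by (intro interior_injective_linear_image) (auto simp: linear_scaleR_left inj_on_def)
    then show ?thesis
      using pseudo_cone_interior_nonempty[OF E1] pointed by (simp add: pointed_cone_def)
  qed
  ultimately show ?thesis unfolding c_def[symmetric]
    using pseudo_coneD(1,2)[OF E1] pseudo_coneD(1,2)[OF E2] pseudo_cone_interior_nonempty[OF E2] pointed
    by (intro convex_eq_if_AE_eq) (auto simp: closed_scaling convex_scaling pointed_cone_def)
qed

lemma wcovol_msum_le:
  assumes E1: "pseudo_cone C E1" and E2: "pseudo_cone C E2"
    and f1: "wcovol E1 < \<infinity>" and f2: "wcovol E2 < \<infinity>"
  defines "a \<equiv> enn2real (wcovol E1) powr (1 / p)" and "b \<equiv> enn2real (wcovol E2) powr (1 / p)"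
  shows "wcovol (msum E1 E2) \<le> ennreal ((a + b) powr p)"
    and "p > 1 \<Longrightarrow> wcovol (msum E1 E2) = ennreal ((a + b) powr p) \<Longrightarrow> dilates E1 E2"
proof -
  define M where "M = density lborel (\<lambda>x. weight x * indicator {x. norm x < 1} x)"
  have [measurable]: "radial E1 \<in> borel_measurable M" "radial E2 \<in> borel_measurable M"
    using E1 E2 by (simp_all add: M_def radial_borel_measurable)
  have int_radial: "(\<integral>\<^sup>+x. ennreal (radial E x powr p) \<partial>M)
      = ennreal ((enn2real (wcovol E) powr (1 / p)) powr p)"
    if E: "pseudo_cone C E" and f: "wcovol E < \<infinity>" for E
    using wcovol_eq_radial[OF E f] f p_ge_1 radial_borel_measurable[OF E]
    by (simp add: M_def nn_integral_density powr_powr mult.assoc)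
  have "enn2real (wcovol E1) > 0" "enn2real (wcovol E2) > 0"
    using wcovol_pos[OF E1] wcovol_pos[OF E2] f1 f2 by (simp_all add: enn2real_positive_iff)
  then have pos: "a > 0" "b > 0" by (simp_all add: a_def b_def)
  note Minkowski = nn_integral_powr_add_le[OF p_ge_1 pos, of "radial E1" M "radial E2"]
  note Minkowski = Minkowski[OF _ _ radial_nonneg[OF E1] radial_nonneg[OF E2]
      int_radial[OF E1 f1, folded a_def] int_radial[OF E2 f2, folded b_def]]
  have sum_le: "wcovol (msum E1 E2) \<le> (\<integral>\<^sup>+x. ennreal ((radial E1 x + radial E2 x) powr p) \<partial>M)"
    using wcovol_msum_le_radial[OF E1 E2 f1 f2] E1 E2 radial_borel_measurable
    by (simp add: M_def nn_integral_density mult.assoc)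
  show "wcovol (msum E1 E2) \<le> ennreal ((a + b) powr p)"
    using sum_le Minkowski(1) by auto
  assume "p > 1" and eq: "wcovol (msum E1 E2) = ennreal ((a + b) powr p)"
  then have "AE x in M. radial E1 x * b = radial E2 x * a"
    using sum_le Minkowski by (intro Minkowski(2)) (auto intro: antisym)
  then have "AE x in lborel. 0 < weight x * indicator {x. norm x < 1} x \<longrightarrow>
      radial E1 x * b = radial E2 x * a"
    unfolding M_def by (subst (asm) AE_density) auto
  then have "E2 = (\<lambda>x. (b / a) *\<^sub>R x) ` E1"
    by (rule dilate_if_AE_radial_proportional[OF E1 E2 f1 f2 pos])
  then show "dilates E1 E2" using pos unfolding dilates_def by (intro exI[of _ "b / a"]) simp
qed

lemma wcovol_msum_dilate:
  assumes E: "pseudo_cone C E" and f: "wcovol E < \<infinity>" and l: "l > 0"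
  defines "a \<equiv> enn2real (wcovol E) powr (1 / p)"
    and "b \<equiv> enn2real (wcovol ((\<lambda>x. l *\<^sub>R x) ` E)) powr (1 / p)"
  shows "wcovol (msum E ((\<lambda>x. l *\<^sub>R x) ` E)) = ennreal ((a + b) powr p)"
proof -
  define A where "A = enn2real (wcovol E)"
  have A: "A \<ge> 0" "wcovol E = ennreal A" using f by (simp_all add: A_def)
  have "b = l * a"
    using wcovol_dilate[OF pseudo_coneD(1)[OF E] l] A l p_ge_1
    by (simp add: a_def b_def A_def[symmetric] ennreal_mult[symmetric] powr_mult powr_powr)
  then have "(a + b) powr p = ((1 + l) * a) powr p" by (simp add: algebra_simps)
  also have "\<dots> = (1 + l) powr p * a powr p" using l by (simp add: powr_mult a_def)
  also have "a powr p = A" using A p_ge_1 by (simp add: a_def A_def[symmetric] powr_powr)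
  finally have "(a + b) powr p = (1 + l) powr p * A" .
  then show ?thesis
    using wcovol_dilate[OF pseudo_coneD(1)[OF E], of "1 + l"] msum_dilate[OF pseudo_coneD(2)[OF E] l] A l
    by (simp add: ennreal_mult)
qed

lemma covol_msum_powr_le:
  assumes c1: "close_set C \<Theta> E1" and c2: "close_set C \<Theta> E2"
  defines "a \<equiv> enn2real (covol C \<Theta> E1) powr (1 / p)" and "b \<equiv> enn2real (covol C \<Theta> E2) powr (1 / p)"
  shows "covol C \<Theta> (msum E1 E2) < \<infinity>"
    and "enn2real (covol C \<Theta> (msum E1 E2)) powr (1 / p) \<le> a + b"
    and "p > 1 \<Longrightarrow> enn2real (covol C \<Theta> (msum E1 E2)) powr (1 / p) = a + b \<longleftrightarrow> dilates E1 E2"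
proof -
  have E1: "pseudo_cone C E1" and E2: "pseudo_cone C E2"
    and f1: "wcovol E1 < \<infinity>" and f2: "wcovol E2 < \<infinity>"
    using c1 c2 by (auto simp: close_set_def covol_eq_wcovol)
  note le = wcovol_msum_le[OF E1 E2 f1 f2, folded covol_eq_wcovol, folded a_def b_def]
  have ab: "a + b \<ge> 0" "p > 0" using p_ge_1 by (simp_all add: a_def b_def)
  show finite: "covol C \<Theta> (msum E1 E2) < \<infinity>"
    using le(1) by (auto intro: le_less_trans)
  show "enn2real (covol C \<Theta> (msum E1 E2)) powr (1 / p) \<le> a + b"
    using le(1) finite ab by (simp add: powr_inverse_le_iff enn2real_leI)
  assume "p > 1"
  have "enn2real (covol C \<Theta> (msum E1 E2)) powr (1 / p) = a + b
      \<longleftrightarrow> covol C \<Theta> (msum E1 E2) = ennreal ((a + b) powr p)"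
  proof -
    have "ennreal (enn2real (covol C \<Theta> (msum E1 E2))) = covol C \<Theta> (msum E1 E2)"
      using finite by simp
    then show ?thesis using ab by (auto simp: powr_inverse_eq_iff)
  qed
  also have "\<dots> \<longleftrightarrow> dilates E1 E2"
  proof
    assume "dilates E1 E2"
    then obtain l where "l > 0" "E2 = (\<lambda>x. l *\<^sub>R x) ` E1" by (auto simp: dilates_def)
    then show "covol C \<Theta> (msum E1 E2) = ennreal ((a + b) powr p)"
      using wcovol_msum_dilate[OF E1 f1] by (simp add: a_def b_def covol_eq_wcovol)
  qed (rule le(2)[OF \<open>p > 1\<close>])
  finally show "enn2real (covol C \<Theta> (msum E1 E2)) powr (1 / p) = a + b \<longleftrightarrow> dilates E1 E2" .
qed

end

theorem theorem1p3:
  fixes C :: "'a::euclidean_space set" and \<Theta> :: "'a \<Rightarrow> real" and q :: real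
    and E1 E2 :: "'a set"
  assumes "DIM('a) \<ge> 2"
    and "pointed_cone C"
    and "0 \<le> q" and "q \<le> real DIM('a) - 1"
    and "continuous_on (C - {0}) \<Theta>"
    and "\<forall>x\<in>C - {0}. \<Theta> x > 0"
    and "\<forall>x\<in>C - {0}. \<forall>t::real. t > 0 \<longrightarrow> \<Theta> (t *\<^sub>R x) = t powr (- q) * \<Theta> x"
    and "close_set C \<Theta> E1" and "close_set C \<Theta> E2"
  shows "covol C \<Theta> (msum E1 E2) < \<infinity> \<and>
         enn2real (covol C \<Theta> (msum E1 E2)) powr (1 / (real DIM('a) - q))
           \<le> enn2real (covol C \<Theta> E1) powr (1 / (real DIM('a) - q))
            + enn2real (covol C \<Theta> E2) powr (1 / (real DIM('a) - q))
         \<and> (q < real DIM('a) - 1 \<longrightarrow>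
             (enn2real (covol C \<Theta> (msum E1 E2)) powr (1 / (real DIM('a) - q))
               = enn2real (covol C \<Theta> E1) powr (1 / (real DIM('a) - q))
                + enn2real (covol C \<Theta> E2) powr (1 / (real DIM('a) - q)))
             \<longleftrightarrow> dilates E1 E2)"
proof -
  interpret homogeneous_weight C \<Theta> q
    using assms(2,4-7) by unfold_locales auto
  have "real DIM('a) - q = p" "q < real DIM('a) - 1 \<longleftrightarrow> p > 1" by (auto simp: p_def)
  then show ?thesis using covol_msum_powr_le[OF assms(8,9)] by simp
qed

end
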